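(* Let $M$ be a commutative metric value set and let $(X,\mathcal{T})$ be an $M$-metrizable topological space. Then there exists a partially ordered commutative metric value set $N$ such that $(X,\mathcal{T})$ is $N$-metrizable.
   Context: A metric value set (MVS) is a set $M$ with at least two elements and a binary operation $+$ such that: (M1) $+$ is associative; (M2) $+$ has a (then unique) neutral element $e$ (write $M^{*}=M\setminus\{e\}$); (M3) if $m_1+m_2=e$ then $m_1=m_2=e$; (M4) for every $m_1,m_2\in M^{*}$ there are $m_3\in M^{*}$ and $m_4,m_5\in M$ with $m_1=m_3+m_4$ and $m_2=m_3+m_5$. It is commutative if $+$ is commutative. Induced relations: $m_1\unlhd m_2$ if there is $m_3\in M$ with $m_1+m_3=m_2$; $m_1\lhd m_2$ if there is $m_3\in M^{*}$ with $m_1+m_3=m_2$. The relation $\unlhd$ is always reflexive and transitive; the MVS is called partially ordered if $\unlhd$ is also antisymmetric. A quasimetric function is a map $f\colon X\times X\to M$, with $X$ a set and $M$ an MVS, such that $f(x,z)\unlhd f(x,y)+f(y,z)$ for all $x,y,z\in X$ and $f(x,x)=e$ for all $x\in X$. The topology $\mathcal{T}_f$ on $X$ induced by $f$ is the one for which, for every $x\in X$, the family of open balls $B_f(x,m)=\{y\in X: f(x,y)\lhd m\}$, $m\in M^{*}$, is an open neighbourhood base at $x$. A topological space $(X,\mathcal{T})$ is $M$-metrizable if there is a quasimetric function $f\colon X\times X\to M$ with $\mathcal{T}_f=\mathcal{T}$. *)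

theory Defs
  imports "HOL-Algebra.Group" "HOL-Analysis.Locally"
begin

text \<open>
  A metric value set is rendered as a structure of type \<^typ>\<open>'m monoid\<close>: the set is
  \<^term>\<open>carrier M\<close>, the operation \<open>+\<close> is \<open>\<otimes>\<close> and the neutral element \<open>e\<close> is \<open>\<one>\<close>.
\<close>

definition nonneutral :: "('m, 'b) monoid_scheme \<Rightarrow> 'm set"
  where "nonneutral M = carrier M - {\<one>\<^bsub>M\<^esub>}"

locale metric_value_set = monoid M for M (structure) +
  assumes two_elements: "\<exists>a\<in>carrier M. \<exists>b\<in>carrier M. a \<noteq> b"
    and conical:
      "\<lbrakk>m1 \<in> carrier M; m2 \<in> carrier M; m1 \<otimes> m2 = \<one>\<rbrakk> \<Longrightarrow> m1 = \<one> \<and> m2 = \<one>"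
    and common_left_part:
      "\<lbrakk>m1 \<in> nonneutral M; m2 \<in> nonneutral M\<rbrakk> \<Longrightarrow>
        \<exists>m3\<in>nonneutral M. \<exists>m4\<in>carrier M. \<exists>m5\<in>carrier M.
          m1 = m3 \<otimes> m4 \<and> m2 = m3 \<otimes> m5"

locale comm_metric_value_set = metric_value_set M + comm_monoid M for M (structure)

definition mvs_le :: "('m, 'b) monoid_scheme \<Rightarrow> 'm \<Rightarrow> 'm \<Rightarrow> bool"
  where "mvs_le M m1 m2 \<longleftrightarrow> (\<exists>m3\<in>carrier M. m1 \<otimes>\<^bsub>M\<^esub> m3 = m2)"

definition mvs_less :: "('m, 'b) monoid_scheme \<Rightarrow> 'm \<Rightarrow> 'm \<Rightarrow> bool"
  where "mvs_less M m1 m2 \<longleftrightarrow> (\<exists>m3\<in>nonneutral M. m1 \<otimes>\<^bsub>M\<^esub> m3 = m2)"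

definition mvs_partially_ordered :: "('m, 'b) monoid_scheme \<Rightarrow> bool"
  where "mvs_partially_ordered M \<longleftrightarrow> antisymp_on (carrier M) (mvs_le M)"

definition quasimetric_function ::
    "('m, 'b) monoid_scheme \<Rightarrow> 'a set \<Rightarrow> ('a \<Rightarrow> 'a \<Rightarrow> 'm) \<Rightarrow> bool"
  where "quasimetric_function M X f \<longleftrightarrow>
    (\<forall>x\<in>X. \<forall>y\<in>X. f x y \<in> carrier M) \<and>
    (\<forall>x\<in>X. \<forall>y\<in>X. \<forall>z\<in>X. mvs_le M (f x z) (f x y \<otimes>\<^bsub>M\<^esub> f y z)) \<and>
    (\<forall>x\<in>X. f x x = \<one>\<^bsub>M\<^esub>)"

definition mvs_ball ::
    "('m, 'b) monoid_scheme \<Rightarrow> 'a set \<Rightarrow> ('a \<Rightarrow> 'a \<Rightarrow> 'm) \<Rightarrow> 'a \<Rightarrow> 'm \<Rightarrow> 'a set"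
  where "mvs_ball M X f x m = {y \<in> X. mvs_less M (f x y) m}"

definition open_neighbourhood_base_at :: "'a topology \<Rightarrow> 'a \<Rightarrow> 'a set set \<Rightarrow> bool"
  where "open_neighbourhood_base_at T x \<B> \<longleftrightarrow>
    (\<forall>B\<in>\<B>. openin T B \<and> x \<in> B) \<and> neighbourhood_base_at x (\<lambda>B. B \<in> \<B>) T"

definition has_ball_bases ::
    "('m, 'b) monoid_scheme \<Rightarrow> 'a set \<Rightarrow> ('a \<Rightarrow> 'a \<Rightarrow> 'm) \<Rightarrow> 'a topology \<Rightarrow> bool"
  where "has_ball_bases M X f T \<longleftrightarrow>
    topspace T = X \<and>
    (\<forall>x\<in>X. open_neighbourhood_base_at T x (mvs_ball M X f x ` nonneutral M))"

text \<open>
  The description below is justified by the lemma \<open>ex1_has_ball_bases\<close>: for a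
  quasimetric function into a metric value set there is exactly one such topology.
\<close>

definition induced_topology ::
    "('m, 'b) monoid_scheme \<Rightarrow> 'a set \<Rightarrow> ('a \<Rightarrow> 'a \<Rightarrow> 'm) \<Rightarrow> 'a topology"
  where "induced_topology M X f = (THE T. has_ball_bases M X f T)"

definition mvs_metrizable :: "('m, 'b) monoid_scheme \<Rightarrow> 'a topology \<Rightarrow> bool"
  where "mvs_metrizable M T \<longleftrightarrow>
    (\<exists>f. quasimetric_function M (topspace T) f \<and> induced_topology M (topspace T) f = T)"

lemma has_ball_bases_openin_iff:
  assumes "has_ball_bases M X f T"
  shows "openin T U \<longleftrightarrow> U \<subseteq> X \<and> (\<forall>x\<in>U. \<exists>m\<in>nonneutral M. mvs_ball M X f x m \<subseteq> U)"
proof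
  assume U: "openin T U"
  with assms have "U \<subseteq> X"
    using has_ball_bases_def openin_subset by metis
  moreover have "\<exists>m\<in>nonneutral M. mvs_ball M X f x m \<subseteq> U" if x: "x \<in> U" for x
  proof -
    have "neighbourhood_base_at x (\<lambda>B. B \<in> mvs_ball M X f x ` nonneutral M) T"
      using assms x \<open>U \<subseteq> X\<close>
      unfolding has_ball_bases_def open_neighbourhood_base_at_def by blast
    then show ?thesis
      using U x unfolding neighbourhood_base_at_def by blast
  qed
  ultimately show "U \<subseteq> X \<and> (\<forall>x\<in>U. \<exists>m\<in>nonneutral M. mvs_ball M X f x m \<subseteq> U)"
    by blast
next
  assume R: "U \<subseteq> X \<and> (\<forall>x\<in>U. \<exists>m\<in>nonneutral M. mvs_ball M X f x m \<subseteq> U)"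
  show "openin T U"
  proof (subst openin_subopen, intro ballI)
    fix x assume x: "x \<in> U"
    with R obtain m where m: "m \<in> nonneutral M" "mvs_ball M X f x m \<subseteq> U" by blast
    have "openin T (mvs_ball M X f x m) \<and> x \<in> mvs_ball M X f x m"
      using assms x R m(1)
      unfolding has_ball_bases_def open_neighbourhood_base_at_def by blast
    with m show "\<exists>V. openin T V \<and> x \<in> V \<and> V \<subseteq> U" by blast
  qed
qed

context metric_value_set
begin

lemma nonneutral_mult:
  assumes "a \<in> nonneutral M" "b \<in> carrier M"
  shows "a \<otimes> b \<in> nonneutral M" "b \<otimes> a \<in> nonneutral M"
proof -
  have a: "a \<in> carrier M" "a \<noteq> \<one>" using assms(1) unfolding nonneutral_def by blast+
  show "a \<otimes> b \<in> nonneutral M"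
    unfolding nonneutral_def using a assms(2) conical[of a b] by blast
  show "b \<otimes> a \<in> nonneutral M"
    unfolding nonneutral_def using a assms(2) conical[of b a] by blast
qed

lemma mvs_ball_mono:
  assumes "quasimetric_function M X f" "x \<in> X" "m3 \<in> nonneutral M" "m4 \<in> carrier M"
  shows "mvs_ball M X f x m3 \<subseteq> mvs_ball M X f x (m3 \<otimes> m4)"
proof
  fix y assume y: "y \<in> mvs_ball M X f x m3"
  then obtain k where k: "y \<in> X" "k \<in> nonneutral M" "f x y \<otimes> k = m3"
    unfolding mvs_ball_def mvs_less_def by blast
  have "f x y \<in> carrier M" "k \<in> carrier M"
    using assms k unfolding quasimetric_function_def nonneutral_def by auto
  then have "f x y \<otimes> (k \<otimes> m4) = m3 \<otimes> m4"
    using k(3) assms(4) by (metis m_assoc)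
  with nonneutral_mult(1)[OF k(2) assms(4)] k(1)
  show "y \<in> mvs_ball M X f x (m3 \<otimes> m4)"
    unfolding mvs_ball_def mvs_less_def by blast
qed

lemma centre_in_mvs_ball:
  assumes "quasimetric_function M X f" "x \<in> X" "m \<in> nonneutral M"
  shows "x \<in> mvs_ball M X f x m"
proof -
  have "f x x = \<one>" using assms(1,2) unfolding quasimetric_function_def by blast
  moreover have "\<one> \<otimes> m = m" using assms(3) unfolding nonneutral_def by simp
  ultimately show ?thesis
    using assms(2,3) unfolding mvs_ball_def mvs_less_def by force
qed

lemma mvs_ball_subset_mvs_ball:
  assumes qm: "quasimetric_function M X f" and x: "x \<in> X"
    and y: "y \<in> mvs_ball M X f x m"
  shows "\<exists>k\<in>nonneutral M. mvs_ball M X f y k \<subseteq> mvs_ball M X f x m"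
proof -
  from y obtain k where k: "y \<in> X" "k \<in> nonneutral M" "f x y \<otimes> k = m"
    unfolding mvs_ball_def mvs_less_def by blast
  have "z \<in> mvs_ball M X f x m" if z: "z \<in> mvs_ball M X f y k" for z
  proof -
    from z obtain l where l: "z \<in> X" "l \<in> nonneutral M" "f y z \<otimes> l = k"
      unfolding mvs_ball_def mvs_less_def by blast
    obtain a where a: "a \<in> carrier M" "f x z \<otimes> a = f x y \<otimes> f y z"
      using qm x k(1) l(1) unfolding quasimetric_function_def mvs_le_def by blast
    have c: "f x z \<in> carrier M" "f x y \<in> carrier M" "f y z \<in> carrier M" "l \<in> carrier M"
      using qm x k(1) l unfolding quasimetric_function_def nonneutral_def by auto
    have "f x z \<otimes> (a \<otimes> l) = m"
      using a c k(3) l(3) by (metis m_assoc)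
    with nonneutral_mult(2)[OF l(2) a(1)] l(1) show ?thesis
      unfolding mvs_ball_def mvs_less_def by blast
  qed
  with k(2) show ?thesis by blast
qed

lemma ex1_has_ball_bases:
  assumes qm: "quasimetric_function M X f"
  shows "\<exists>!T. has_ball_bases M X f T"
proof (rule ex_ex1I)
  define P where
    "P U \<longleftrightarrow> U \<subseteq> X \<and> (\<forall>x\<in>U. \<exists>m\<in>nonneutral M. mvs_ball M X f x m \<subseteq> U)" for U
  have "istopology P"
    unfolding istopology_def
  proof (intro conjI allI impI)
    fix S U assume S: "P S" and U: "P U"
    have "\<exists>m\<in>nonneutral M. mvs_ball M X f x m \<subseteq> S \<inter> U" if x: "x \<in> S \<inter> U" for x
    proof -
      have "x \<in> X" using S x unfolding P_def by blast
      obtain m1 m2 where m: "m1 \<in> nonneutral M" "mvs_ball M X f x m1 \<subseteq> S"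
          "m2 \<in> nonneutral M" "mvs_ball M X f x m2 \<subseteq> U"
        using S U x unfolding P_def by blast
      obtain m3 m4 m5 where m3: "m3 \<in> nonneutral M" "m4 \<in> carrier M" "m5 \<in> carrier M"
          "m1 = m3 \<otimes> m4" "m2 = m3 \<otimes> m5"
        using common_left_part[OF m(1,3)] by blast
      show ?thesis
        using mvs_ball_mono[OF qm \<open>x \<in> X\<close> m3(1,2)] mvs_ball_mono[OF qm \<open>x \<in> X\<close> m3(1,3)] m m3
        by blast
    qed
    with S show "P (S \<inter> U)" unfolding P_def by blast
  next
    fix \<K> assume "\<forall>K\<in>\<K>. P K"
    then show "P (\<Union>\<K>)" unfolding P_def by (intro conjI ballI) (blast, meson UnionE Union_upper subset_trans)
  qed
  then have open_iff: "openin (topology P) = P" by simp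
  obtain m0 where m0: "m0 \<in> nonneutral M"
    using two_elements unfolding nonneutral_def by blast
  have "P X"
    using m0 unfolding P_def mvs_ball_def by blast
  then have top: "topspace (topology P) = X"
    unfolding topspace_def open_iff P_def by blast
  have "P (mvs_ball M X f x m)" if "x \<in> X" for x m
    unfolding P_def using mvs_ball_subset_mvs_ball[OF qm that]
    by (auto simp: mvs_ball_def)
  note balls = this
  have "open_neighbourhood_base_at (topology P) x (mvs_ball M X f x ` nonneutral M)"
    if x: "x \<in> X" for x
    unfolding open_neighbourhood_base_at_def neighbourhood_base_at_def open_iff
  proof (intro conjI ballI allI impI)
    fix W assume "P W \<and> x \<in> W"
    then obtain m where m: "m \<in> nonneutral M" "mvs_ball M X f x m \<subseteq> W"
      unfolding P_def by blast
    then show "\<exists>U V. P U \<and> V \<in> mvs_ball M X f x ` nonneutral M \<and> x \<in> U \<and> U \<subseteq> V \<and> V \<subseteq> W"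
      using balls[OF x] centre_in_mvs_ball[OF qm x] by blast
  qed (use balls[OF x] centre_in_mvs_ball[OF qm x] in auto)
  with top show "\<exists>T. has_ball_bases M X f T"
    unfolding has_ball_bases_def by blast
next
  fix S T assume "has_ball_bases M X f S" "has_ball_bases M X f T"
  then show "S = T"
    using has_ball_bases_openin_iff topology_eq by metis
qed

end

end

theory Submission
  imports Defs
begin

text \<open>
  Write \<open>a \<sim> b\<close> if \<open>a \<unlhd> b\<close> and \<open>b \<unlhd> a\<close>. Commutativity makes \<open>+\<close> monotone for \<open>\<unlhd>\<close>, hence
  \<open>\<sim>\<close> is a congruence, and the quotient \<open>N = M / \<sim>\<close> is again a commutative monoid. By (M3) only
  \<open>e\<close> lies below \<open>e\<close>, so the class of \<open>e\<close> is a singleton; this lets (M3), (M4) and the existence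
  of two elements descend to \<open>N\<close>.

  The quotient map changes neither relation: if \<open>a + k \<sim> b\<close>, then \<open>a + (k + c) = b\<close> for some
  \<open>c\<close>, and \<open>k + c \<noteq> e\<close> whenever \<open>k \<noteq> e\<close>. For \<open>\<unlhd>\<close> this gives the antisymmetry of \<open>N\<close> and
  the triangle inequality for the composition of a quasimetric function with the quotient map
  (\<open>mvs_le_quotient_iff\<close>). For \<open>\<lhd>\<close> it says that a point is in the ball of radius \<open>m\<close> exactly when it
  is in the ball whose radius is the class of \<open>m\<close> (\<open>mvs_less_quotient_iff\<close>). So both functions have
  the same balls, and they induce the same topology.
\<close>

definition le_class :: "('m, 'b) monoid_scheme \<Rightarrow> 'm \<Rightarrow> 'm set"
  where "le_class M a = {b \<in> carrier M. mvs_le M a b \<and> mvs_le M b a}"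

text \<open>
  Taking the union over all representatives avoids choosing one; all sets in this union
  coincide by \<open>le_class_mult_cong\<close>.
\<close>

definition order_quotient :: "('m, 'b) monoid_scheme \<Rightarrow> 'm set monoid"
  where "order_quotient M =
    \<lparr>carrier = le_class M ` carrier M,
     monoid.mult = (\<lambda>A B. \<Union>a\<in>A. \<Union>b\<in>B. le_class M (a \<otimes>\<^bsub>M\<^esub> b)),
     one = le_class M \<one>\<^bsub>M\<^esub>\<rparr>"

lemma carrier_order_quotient: "carrier (order_quotient M) = le_class M ` carrier M"
  and one_order_quotient: "\<one>\<^bsub>order_quotient M\<^esub> = le_class M \<one>\<^bsub>M\<^esub>"
  by (simp_all add: order_quotient_def)

context comm_metric_value_set
begin

lemma nonneutral_closed: "a \<in> nonneutral M \<Longrightarrow> a \<in> carrier M"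
  by (simp add: nonneutral_def)

lemma mvs_le_refl: "a \<in> carrier M \<Longrightarrow> mvs_le M a a"
  unfolding mvs_le_def using r_one by blast

lemma mvs_le_trans:
  assumes "a \<in> carrier M" "mvs_le M a b" "mvs_le M b c"
  shows "mvs_le M a c"
proof -
  from assms obtain k l where "k \<in> carrier M" "l \<in> carrier M" "a \<otimes> k = b" "b \<otimes> l = c"
    unfolding mvs_le_def by blast
  with assms(1) have "k \<otimes> l \<in> carrier M" "a \<otimes> (k \<otimes> l) = c"
    by (auto simp: m_assoc)
  then show ?thesis unfolding mvs_le_def by blast
qed

lemma mvs_le_mult_mono:
  assumes "a \<in> carrier M" "b \<in> carrier M" "mvs_le M a a'" "mvs_le M b b'"
  shows "mvs_le M (a \<otimes> b) (a' \<otimes> b')"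
proof -
  from assms obtain k l where "k \<in> carrier M" "l \<in> carrier M" "a \<otimes> k = a'" "b \<otimes> l = b'"
    unfolding mvs_le_def by blast
  with assms(1,2) have "k \<otimes> l \<in> carrier M" "(a \<otimes> b) \<otimes> (k \<otimes> l) = a' \<otimes> b'"
    by (auto simp: m_ac)
  then show ?thesis unfolding mvs_le_def by blast
qed

lemma le_class_eq_iff:
  assumes "a \<in> carrier M" "b \<in> carrier M"
  shows "le_class M a = le_class M b \<longleftrightarrow> mvs_le M a b \<and> mvs_le M b a"
  using assms mvs_le_refl mvs_le_trans unfolding le_class_def by blast

lemma le_class_mult_cong:
  assumes "a \<in> carrier M" "b \<in> carrier M" "a' \<in> le_class M a" "b' \<in> le_class M b"
  shows "le_class M (a' \<otimes> b') = le_class M (a \<otimes> b)"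
proof -
  have "a' \<in> carrier M" "b' \<in> carrier M" "mvs_le M a a'" "mvs_le M a' a"
    "mvs_le M b b'" "mvs_le M b' b"
    using assms(3,4) by (auto simp: le_class_def)
  with assms(1,2) show ?thesis
    by (simp add: le_class_eq_iff mvs_le_mult_mono)
qed

lemma mult_order_quotient:
  assumes "a \<in> carrier M" "b \<in> carrier M"
  shows "le_class M a \<otimes>\<^bsub>order_quotient M\<^esub> le_class M b = le_class M (a \<otimes> b)"
proof -
  have "a \<in> le_class M a" "b \<in> le_class M b"
    using assms mvs_le_refl by (auto simp: le_class_def)
  moreover have "(\<Union>a'\<in>le_class M a. \<Union>b'\<in>le_class M b. le_class M (a' \<otimes> b')) =
      (\<Union>a'\<in>le_class M a. \<Union>b'\<in>le_class M b. le_class M (a \<otimes> b))"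
    by (intro SUP_cong refl le_class_mult_cong[OF assms])
  ultimately show ?thesis
    by (auto simp: order_quotient_def)
qed

text \<open>Conicality leaves nothing but \<open>e\<close> below \<open>e\<close>, so nonneutral elements stay nonneutral in the quotient.\<close>

lemma le_class_eq_one_iff:
  assumes "a \<in> carrier M"
  shows "le_class M a = le_class M \<one> \<longleftrightarrow> a = \<one>"
proof
  assume "le_class M a = le_class M \<one>"
  then have "mvs_le M a \<one>"
    using assms by (simp add: le_class_eq_iff)
  then show "a = \<one>"
    using assms conical unfolding mvs_le_def by blast
qed simp

lemma nonneutral_order_quotient: "nonneutral (order_quotient M) = le_class M ` nonneutral M"
  unfolding nonneutral_def carrier_order_quotient one_order_quotient
  using le_class_eq_one_iff by blast

lemma comm_metric_value_set_order_quotient: "comm_metric_value_set (order_quotient M)"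
proof -
  have "comm_monoid (order_quotient M)"
    by (rule comm_monoidI)
      (auto simp: carrier_order_quotient one_order_quotient mult_order_quotient m_ac)
  moreover have "metric_value_set_axioms (order_quotient M)"
  proof
    obtain a where "a \<in> carrier M" "a \<noteq> \<one>" using two_elements by metis
    then have "le_class M a \<noteq> le_class M \<one>" by (simp add: le_class_eq_one_iff)
    with \<open>a \<in> carrier M\<close>
    show "\<exists>A\<in>carrier (order_quotient M). \<exists>B\<in>carrier (order_quotient M). A \<noteq> B"
      unfolding carrier_order_quotient by (meson imageI one_closed)
  next
    fix A B
    assume "A \<in> carrier (order_quotient M)" "B \<in> carrier (order_quotient M)"
      "A \<otimes>\<^bsub>order_quotient M\<^esub> B = \<one>\<^bsub>order_quotient M\<^esub>"
    moreover from this(1,2) obtain a b where ab: "a \<in> carrier M" "b \<in> carrier M"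
        "A = le_class M a" "B = le_class M b"
      by (auto simp: carrier_order_quotient)
    ultimately have "a \<otimes> b = \<one>"
      by (simp add: one_order_quotient mult_order_quotient le_class_eq_one_iff)
    with conical[OF ab(1,2)] ab(3,4)
    show "A = \<one>\<^bsub>order_quotient M\<^esub> \<and> B = \<one>\<^bsub>order_quotient M\<^esub>"
      by (simp add: one_order_quotient)
  next
    fix A B
    assume "A \<in> nonneutral (order_quotient M)" "B \<in> nonneutral (order_quotient M)"
    then obtain a b where ab: "a \<in> nonneutral M" "b \<in> nonneutral M"
        "A = le_class M a" "B = le_class M b"
      by (auto simp: nonneutral_order_quotient)
    obtain c k l where c: "c \<in> nonneutral M" "k \<in> carrier M" "l \<in> carrier M"
        "a = c \<otimes> k" "b = c \<otimes> l"
      using common_left_part[OF ab(1,2)] by blast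
    have "A = le_class M c \<otimes>\<^bsub>order_quotient M\<^esub> le_class M k"
      "B = le_class M c \<otimes>\<^bsub>order_quotient M\<^esub> le_class M l"
      using ab c nonneutral_closed by (simp_all add: mult_order_quotient)
    with c show "\<exists>C\<in>nonneutral (order_quotient M). \<exists>K\<in>carrier (order_quotient M).
        \<exists>L\<in>carrier (order_quotient M).
        A = C \<otimes>\<^bsub>order_quotient M\<^esub> K \<and> B = C \<otimes>\<^bsub>order_quotient M\<^esub> L"
      unfolding nonneutral_order_quotient carrier_order_quotient by blast
  qed
  ultimately show ?thesis
    by (simp add: comm_metric_value_set_def metric_value_set_def comm_monoid.axioms)
qed

lemma mvs_le_quotient_iff:
  assumes "a \<in> carrier M" "b \<in> carrier M"
  shows "mvs_le (order_quotient M) (le_class M a) (le_class M b) \<longleftrightarrow> mvs_le M a b"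
proof
  assume "mvs_le (order_quotient M) (le_class M a) (le_class M b)"
  then obtain k where k: "k \<in> carrier M" "le_class M (a \<otimes> k) = le_class M b"
    using assms by (auto simp: mvs_le_def carrier_order_quotient mult_order_quotient)
  then have "mvs_le M (a \<otimes> k) b"
    using assms by (simp add: le_class_eq_iff)
  moreover have "mvs_le M a (a \<otimes> k)"
    using k(1) unfolding mvs_le_def by blast
  ultimately show "mvs_le M a b"
    using assms(1) mvs_le_trans by blast
next
  assume "mvs_le M a b"
  then show "mvs_le (order_quotient M) (le_class M a) (le_class M b)"
    using assms(1) mult_order_quotient
    unfolding mvs_le_def carrier_order_quotient by blast
qed

text \<open>
  Even though \<open>a + k\<close> only has to be equivalent to \<open>b\<close>, the element that corrects \<open>a + k\<close> to \<open>b\<close>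
  can be absorbed into \<open>k\<close>, and conicality keeps the sum different from \<open>e\<close>.
\<close>

lemma mvs_less_quotient_iff:
  assumes "a \<in> carrier M" "b \<in> carrier M"
  shows "mvs_less (order_quotient M) (le_class M a) (le_class M b) \<longleftrightarrow> mvs_less M a b"
proof
  assume "mvs_less (order_quotient M) (le_class M a) (le_class M b)"
  then obtain k where k: "k \<in> nonneutral M" "le_class M (a \<otimes> k) = le_class M b"
    using assms nonneutral_closed
    by (auto simp: mvs_less_def nonneutral_order_quotient mult_order_quotient)
  then have "mvs_le M (a \<otimes> k) b"
    using assms nonneutral_closed by (simp add: le_class_eq_iff)
  then obtain c where c: "c \<in> carrier M" "(a \<otimes> k) \<otimes> c = b"
    unfolding mvs_le_def by blast
  then have "a \<otimes> (k \<otimes> c) = b"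
    using assms(1) k(1) nonneutral_closed by (simp add: m_assoc)
  with nonneutral_mult(1)[OF k(1) c(1)] show "mvs_less M a b"
    unfolding mvs_less_def by blast
next
  assume "mvs_less M a b"
  then show "mvs_less (order_quotient M) (le_class M a) (le_class M b)"
    using assms(1) mult_order_quotient nonneutral_closed
    unfolding mvs_less_def nonneutral_order_quotient by blast
qed

lemma mvs_partially_ordered_order_quotient: "mvs_partially_ordered (order_quotient M)"
  unfolding mvs_partially_ordered_def
proof (rule antisymp_onI)
  fix A B
  assume "A \<in> carrier (order_quotient M)" "B \<in> carrier (order_quotient M)"
    and le: "mvs_le (order_quotient M) A B" "mvs_le (order_quotient M) B A"
  then obtain a b where ab: "a \<in> carrier M" "b \<in> carrier M" "A = le_class M a" "B = le_class M b"
    by (auto simp: carrier_order_quotient)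
  with le show "A = B"
    by (simp add: mvs_le_quotient_iff le_class_eq_iff)
qed

lemma quasimetric_function_le_class:
  assumes "quasimetric_function M X f"
  shows "quasimetric_function (order_quotient M) X (\<lambda>x y. le_class M (f x y))"
  using assms unfolding quasimetric_function_def
  by (auto simp: carrier_order_quotient one_order_quotient mult_order_quotient mvs_le_quotient_iff)

lemma induced_topology_le_class:
  assumes "quasimetric_function M X f"
  shows "induced_topology (order_quotient M) X (\<lambda>x y. le_class M (f x y)) =
    induced_topology M X f"
proof -
  have "mvs_ball (order_quotient M) X (\<lambda>x y. le_class M (f x y)) x (le_class M m) =
      mvs_ball M X f x m" if "x \<in> X" "m \<in> nonneutral M" for x m
    using assms that nonneutral_closed mvs_less_quotient_iff
    unfolding mvs_ball_def quasimetric_function_def by blast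
  then have "mvs_ball (order_quotient M) X (\<lambda>x y. le_class M (f x y)) x `
      nonneutral (order_quotient M) = mvs_ball M X f x ` nonneutral M" if "x \<in> X" for x
    using that unfolding nonneutral_order_quotient image_image by simp
  then show ?thesis
    unfolding induced_topology_def has_ball_bases_def by simp
qed

end

theorem theorem2p20:
  fixes M :: "'m monoid" and T :: "'a topology"
  assumes "comm_metric_value_set M"
    and "mvs_metrizable M T"
  shows "\<exists>N :: 'm set monoid.
    comm_metric_value_set N \<and> mvs_partially_ordered N \<and> mvs_metrizable N T"
proof -
  interpret comm_metric_value_set M by (fact assms(1))
  from assms(2) obtain f where f: "quasimetric_function M (topspace T) f"
      "induced_topology M (topspace T) f = T"
    unfolding mvs_metrizable_def by blast
  have "mvs_metrizable (order_quotient M) T"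
    unfolding mvs_metrizable_def
    using quasimetric_function_le_class[OF f(1)] induced_topology_le_class[OF f(1)] f(2)
    by metis
  then show ?thesis
    using comm_metric_value_set_order_quotient mvs_partially_ordered_order_quotient by blast
qed

end
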